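(* Let $(X_1,\dots,X_M)$ have density $f\in\mathrm{MMEam}$ of the form $f(x_1,\dots,x_M)=\sum_{\mathbf i\in\mathscr S}p_{\mathbf i}f_{i_1}(x_1)\cdots f_{i_M}(x_M)$. Then for $1\le j_1,j_2\le M$, Kendall's tau of $(X_{j_1},X_{j_2})$ is $$\tau(X_{j_1},X_{j_2})=4\sum_{\mathbf i,\mathbf i'\in\mathscr S}p_{\mathbf i}p_{\mathbf i'}\,c_{\mathbf i,\mathbf i'}(j_1)\,c_{\mathbf i,\mathbf i'}(j_2)-1,$$ where, for $1\le r\le M$, $$c_{\mathbf i,\mathbf i'}(r)=1-(\alpha_{i_r}\otimes\alpha_{i'_r})\big(-(T_{i_r}\oplus T_{i'_r})\big)^{-1}(l_{i_r}\otimes t_{i'_r}).$$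
   Context: An ME density is a probability density on $[0,\infty)$ of the form $g(x)=\alpha e^{Tx}t$ ($\alpha$ real row vector, $T$ real square matrix, $t$ real column vector); triples are taken with all eigenvalues of $T$ having strictly negative real part, and $l=(-T)^{-1}t$. MMEam: fix $L,M\in\mathbb N_+$ and ME densities $f_1,\dots,f_L$ with triples $(\alpha_j,T_j,t_j)$, $l_j=(-T_j)^{-1}t_j$. Let $\mathscr S=\{1,\dots,L\}^M$, $\mathbf i=(i_1,\dots,i_M)$, $\mathbf i'=(i'_1,\dots,i'_M)$, and real numbers $p_{\mathbf i}$ (possibly negative) with $\sum p_{\mathbf i}=1$; $f(x)=\sum_{\mathbf i}p_{\mathbf i}f_{i_1}(x_1)\cdots f_{i_M}(x_M)$ on $[0,\infty)^M$ is an MMEam density if $f\ge0$. $\otimes$ is the Kronecker product and $A\oplus B=A\otimes I+I\otimes B$ the Kronecker sum. Kendall's tau of a random pair $(Y,Z)$ is $\tau(Y,Z)=\mathbb P((Y_1-Y_2)(Z_1-Z_2)>0)-\mathbb P((Y_1-Y_2)(Z_1-Z_2)<0)$ with $(Y_1,Z_1),(Y_2,Z_2)$ independent copies of $(Y,Z)$.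
   Formalization: The formula is proved for distinct coordinates j_1 ≠ j_2 only; for j_1 = j_2 it is false: a single exponential density has c = 1/2, so the formula gives 0, while τ(X,X) = 1. *)

theory Defs
  imports "HOL-Probability.Probability"
    "Jordan_Normal_Form.Matrix" "Jordan_Normal_Form.Char_Poly"
    "Jordan_Normal_Form.Gauss_Jordan_Elimination"
begin

definition mat_exp :: "real mat \<Rightarrow> real mat" where
  "mat_exp A = mat (dim_row A) (dim_col A)
     (\<lambda>(i,j). (\<Sum>k. (A ^\<^sub>m k) $$ (i,j) / fact k))"

definition kron_mat :: "real mat \<Rightarrow> real mat \<Rightarrow> real mat" where
  "kron_mat A B = mat (dim_row A * dim_row B) (dim_col A * dim_col B)
     (\<lambda>(i,j). A $$ (i div dim_row B, j div dim_col B) * B $$ (i mod dim_row B, j mod dim_col B))"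

definition kron_vec :: "real vec \<Rightarrow> real vec \<Rightarrow> real vec" where
  "kron_vec a b = vec (dim_vec a * dim_vec b) (\<lambda>i. a $ (i div dim_vec b) * b $ (i mod dim_vec b))"

definition kron_sum :: "real mat \<Rightarrow> real mat \<Rightarrow> real mat" where
  "kron_sum A B = kron_mat A (1\<^sub>m (dim_row B)) + kron_mat (1\<^sub>m (dim_row A)) B"

(* matrix inverse (used only for invertible matrices) *)
definition mat_inv :: "real mat \<Rightarrow> real mat" where
  "mat_inv A = the (mat_inverse A)"

definition ME_fun :: "real vec \<Rightarrow> real mat \<Rightarrow> real vec \<Rightarrow> real \<Rightarrow> real" where
  "ME_fun \<alpha> T t x = \<alpha> \<bullet> (mat_exp (x \<cdot>\<^sub>m T) *\<^sub>v t)"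

definition ME_triple :: "nat \<Rightarrow> real vec \<Rightarrow> real mat \<Rightarrow> real vec \<Rightarrow> bool" where
  "ME_triple n \<alpha> T t \<longleftrightarrow>
     \<alpha> \<in> carrier_vec n \<and> T \<in> carrier_mat n n \<and> t \<in> carrier_vec n \<and>
     (\<forall>ev. eigenvalue (map_mat complex_of_real T) ev \<longrightarrow> Re ev < 0) \<and>
     (\<forall>x\<ge>0. ME_fun \<alpha> T t x \<ge> 0) \<and>
     (ME_fun \<alpha> T t has_integral 1) {0..}"

definition ME_l :: "real mat \<Rightarrow> real vec \<Rightarrow> real vec" where
  "ME_l T t = mat_inv (- T) *\<^sub>v t"

(* Kendall's tau of a pair with joint law \<mu> on \<real>\<^sup>2: (Y1,Z1),(Y2,Z2) independent copies,
   i.e. their joint law is \<mu> \<Otimes> \<mu> *)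
definition kendall_tau :: "(real \<times> real) measure \<Rightarrow> real" where
  "kendall_tau \<mu> =
     measure (\<mu> \<Otimes>\<^sub>M \<mu>) {((y1,z1),(y2,z2)). (y1 - y2) * (z1 - z2) > 0}
   - measure (\<mu> \<Otimes>\<^sub>M \<mu>) {((y1,z1),(y2,z2)). (y1 - y2) * (z1 - z2) < 0}"

(* MMEam density (index set S = {0..<L}^{0..<m}, 0-based indices) *)
definition MMEam_fun :: "nat \<Rightarrow> nat \<Rightarrow> (nat \<Rightarrow> real vec) \<Rightarrow> (nat \<Rightarrow> real mat) \<Rightarrow> (nat \<Rightarrow> real vec)
    \<Rightarrow> ((nat \<Rightarrow> nat) \<Rightarrow> real) \<Rightarrow> (nat \<Rightarrow> real) \<Rightarrow> real" where
  "MMEam_fun L m \<alpha> T t p x =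
     (\<Sum>i\<in>PiE {..<m} (\<lambda>_. {..<L}). p i * (\<Prod>r<m. ME_fun (\<alpha> (i r)) (T (i r)) (t (i r)) (x r)))"

definition c_coef :: "(nat \<Rightarrow> real vec) \<Rightarrow> (nat \<Rightarrow> real mat) \<Rightarrow> (nat \<Rightarrow> real vec)
    \<Rightarrow> (nat \<Rightarrow> nat) \<Rightarrow> (nat \<Rightarrow> nat) \<Rightarrow> nat \<Rightarrow> real" where
  "c_coef \<alpha> T t i i' r =
     1 - kron_vec (\<alpha> (i r)) (\<alpha> (i' r)) \<bullet>
         (mat_inv (- kron_sum (T (i r)) (T (i' r))) *\<^sub>v kron_vec (ME_l (T (i r)) (t (i r))) (t (i' r)))"

end

theory Submission
  imports Defs "Jordan_Normal_Form.Schur_Decomposition"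
begin

text \<open>
  Two independent copies of the pair almost surely have no ties, so by Fubini Kendall's tau is
  \<open>4 E[H(Y,Z)] - 1\<close>, where \<open>H\<close> is the joint distribution function of the pair. For a signed mixture
  of products both \<open>H\<close> and the law factor termwise, which leaves the one-dimensional integrals of
  the distribution function of one component against the density of another.

  The survival function of \<open>\<alpha> exp(x T) t\<close> is \<open>\<alpha> exp(x T) l\<close>, and its product with a second density
  is a bilinear form in \<open>exp(x T) \<otimes> exp(x T')\<close>. This is a semigroup with generator \<open>T \<oplus> T'\<close>
  that decays entrywise, so \<open>T \<oplus> T'\<close> is invertible and the fundamental theorem of calculus
  evaluates the integral. The decay of \<open>exp(x T)\<close> itself is reduced by a Schur decomposition to
  scalar equations \<open>y' = c y + z\<close> with \<open>Re c < 0\<close> and \<open>z \<longrightarrow> 0\<close>.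
\<close>

section \<open>Decay of the matrix exponential\<close>

text \<open>The integrating factor turns the equation into \<open>u' = exp (- c x) z\<close>. Once
  \<open>z\<close> is small, \<open>u\<close> grows no faster than a small multiple of
  \<open>exp (a x)\<close>, and the factor \<open>exp (- a x)\<close> in \<open>norm (y x)\<close>
  cancels that growth.\<close>

lemma linear_ode_tendsto_0:
  fixes y z :: "real \<Rightarrow> complex"
  assumes re: "Re c < 0"
    and y': "\<And>x. (y has_vector_derivative c * y x + z x) (at x)"
    and z: "(z \<longlongrightarrow> 0) at_top"
  shows "(y \<longlongrightarrow> 0) at_top"
proof -
  define a where "a = - Re c"
  have a: "a > 0" using re by (simp add: a_def)
  define u where "u x = exp (- (of_real x * c)) * y x" for x
  have exp': "((\<lambda>x. exp (- (of_real x * c))) has_vector_derivative - c * exp (- (of_real x * c))) (at x)" for x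
  proof -
    have "((\<lambda>w. exp (- (w * c))) has_field_derivative - c * exp (- (of_real x * c))) (at (of_real x))"
      by (auto intro!: derivative_eq_intros)
    from has_vector_derivative_real_field[OF this] show ?thesis .
  qed
  have u': "(u has_vector_derivative exp (- (of_real x * c)) * z x) (at x)" for x
    unfolding u_def
    by (rule has_vector_derivative_eq_rhs[OF has_vector_derivative_mult[OF exp' y']])
       (simp add: algebra_simps)
  have yu: "norm (y x) = exp (- a * x) * norm (u x)" for x
    by (simp add: u_def norm_mult a_def flip: exp_add mult.assoc)
  have step: "eventually (\<lambda>x. norm (y x) \<le> 2 * e) at_top" if e: "e > 0" for e
  proof -
    \<comment> \<open>The threshold \<open>a * e\<close> makes the resulting bound on the derivative
      of \<open>u\<close> beyond \<open>X\<close> exactly the derivative of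
      \<open>e * exp (a * x)\<close>.\<close>
    from z e have "eventually (\<lambda>x. norm (z x) < a * e) at_top"
      unfolding tendsto_iff dist_norm using a by simp
    then obtain X where X: "\<And>x. x \<ge> X \<Longrightarrow> norm (z x) < a * e"
      by (auto simp: eventually_at_top_linorder)
    have *: "norm (y x) \<le> exp (- a * x) * norm (u X) + e" if x: "x > X" for x
    proof -
      have du: "norm (u x - u X) \<le> e * exp (a * x) - e * exp (a * X)"
      proof (rule differentiable_bound_general[OF x])
        show "continuous_on {X..x} u"
          using u' by (intro continuous_at_imp_continuous_on) (auto intro: has_vector_derivative_continuous)
        show "continuous_on {X..x} (\<lambda>x. e * exp (a * x))" by (intro continuous_intros)
        show "((\<lambda>x. e * exp (a * x)) has_vector_derivative e * a * exp (a * s)) (at s)" for s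
          by (rule has_real_derivative_iff_has_vector_derivative[THEN iffD1])
             (auto intro!: derivative_eq_intros)
        show "(u has_vector_derivative exp (- (of_real s * c)) * z s) (at s)" for s
          by (rule u')
        show "norm (exp (- (of_real s * c)) * z s) \<le> e * a * exp (a * s)" if "X < s" "s < x" for s
          using mult_left_mono[OF less_imp_le[OF X[of s]], of "exp (a * s)"] that
          by (simp add: norm_mult a_def mult_ac)
      qed
      have "norm (u x) \<le> norm (u X) + e * exp (a * x)"
        using du norm_triangle_ineq2[of "u x" "u X"] mult_pos_pos[OF e exp_gt_zero[of "a * X"]] by linarith
      hence "exp (- a * x) * norm (u x) \<le> exp (- a * x) * (norm (u X) + e * exp (a * x))"
        by (intro mult_left_mono) auto
      also have "\<dots> = exp (- a * x) * norm (u X) + e"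
        by (simp add: algebra_simps exp_minus_inverse)
      finally show ?thesis by (simp only: yu)
    qed
    have "((\<lambda>x. exp (- a * x) * norm (u X)) \<longlongrightarrow> 0) at_top"
      using a by real_asymp
    hence "eventually (\<lambda>x. exp (- a * x) * norm (u X) < e) at_top"
      by (rule order_tendstoD) (rule e)
    with eventually_gt_at_top[of X] show ?thesis
      by eventually_elim (use * in force)
  qed
  show ?thesis
    unfolding tendsto_iff dist_norm diff_zero
  proof (intro allI impI)
    fix e :: real assume "e > 0"
    with step[of "e / 4"] show "eventually (\<lambda>x. norm (y x) < e) at_top"
      by (auto elim: eventually_mono)
  qed
qed

text \<open>Strong induction on \<open>j\<close>: the equation for \<open>F j\<close> involves only
  \<open>F j\<close> and earlier components, and these already tend to 0 and act as the
  inhomogeneity \<open>z\<close> of the scalar case.\<close>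

lemma triangular_ode_tendsto_0:
  fixes F :: "nat \<Rightarrow> real \<Rightarrow> complex" and B :: "nat \<Rightarrow> nat \<Rightarrow> complex"
  assumes F': "\<And>j x. j < n \<Longrightarrow> (F j has_vector_derivative (\<Sum>k<n. F k x * B k j)) (at x)"
    and tri: "\<And>k j. j < k \<Longrightarrow> k < n \<Longrightarrow> B k j = 0"
    and diag: "\<And>j. j < n \<Longrightarrow> Re (B j j) < 0"
    and "j < n"
  shows "(F j \<longlongrightarrow> 0) at_top"
  using \<open>j < n\<close>
proof (induction j rule: less_induct)
  case (less j)
  show ?case
  proof (rule linear_ode_tendsto_0[OF diag[OF less.prems]])
    have "(\<Sum>k<n. F k x * B k j) = B j j * F j x + (\<Sum>k<j. F k x * B k j)" for x
    proof -
      have "(\<Sum>k<n. F k x * B k j) = (\<Sum>k<Suc j. F k x * B k j)"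
        using less.prems by (intro sum.mono_neutral_right) (auto simp: tri)
      thus ?thesis by simp
    qed
    with F'[OF less.prems]
    show "(F j has_vector_derivative B j j * F j x + (\<Sum>k<j. F k x * B k j)) (at x)" for x
      by simp
    show "((\<lambda>x. \<Sum>k<j. F k x * B k j) \<longlongrightarrow> 0) at_top"
      using less by (intro tendsto_null_sum tendsto_mult_left_zero) auto
  qed
qed

lemma index_mult_mat_sum:
  assumes "A \<in> carrier_mat n m" "B \<in> carrier_mat m k" "i < n" "j < k"
  shows "(A * B) $$ (i,j) = (\<Sum>l<m. A $$ (i,l) * B $$ (l,j))"
  using assms by (auto simp: scalar_prod_def lessThan_atLeast0 intro!: sum.cong)

lemma scalar_prod_mult_mat_vec_sum:
  assumes "a \<in> carrier_vec n" "A \<in> carrier_mat n m" "v \<in> carrier_vec m"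
  shows "scalar_prod a (A *\<^sub>v v) = (\<Sum>i<n. \<Sum>j<m. vec_index a i * A $$ (i,j) * vec_index v j)"
  using assms
  by (auto simp: scalar_prod_def lessThan_atLeast0 sum_distrib_left mult.assoc intro!: sum.cong)

text \<open>Abstracts what a matrix exponential and the Kronecker product of two of them have in
  common. Decay of the latter comes directly from its factors, so no eigenvalues of the Kronecker
  sum have to be determined.\<close>

definition decaying_semigroup :: "nat \<Rightarrow> real mat \<Rightarrow> (real \<Rightarrow> real mat) \<Rightarrow> bool" where
  "decaying_semigroup n S G \<longleftrightarrow> S \<in> carrier_mat n n \<and> (\<forall>x. G x \<in> carrier_mat n n) \<and> G 0 = 1\<^sub>m n \<and>
     (\<forall>i<n. \<forall>j<n. (\<forall>x. ((\<lambda>x. G x $$ (i,j)) has_real_derivative (G x * S) $$ (i,j)) (at x)) \<and>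
        ((\<lambda>x. G x $$ (i,j)) \<longlongrightarrow> 0) at_top)"

text \<open>Each row \<open>g\<close> of \<open>G\<close> solves \<open>g' = g A\<close>. With a
  Schur decomposition \<open>A = P B Q\<close>, the row \<open>F = g P\<close> solves the triangular
  system \<open>F' = F B\<close>, and \<open>g = F Q\<close> inherits its decay.\<close>

lemma mat_ode_tendsto_0:
  assumes S: "S \<in> carrier_mat n n" and G: "\<And>x. G x \<in> carrier_mat n n"
    and G': "\<And>i j x. i < n \<Longrightarrow> j < n \<Longrightarrow>
               ((\<lambda>x. G x $$ (i,j)) has_real_derivative (G x * S) $$ (i,j)) (at x)"
    and ev: "\<And>ev. eigenvalue (map_mat complex_of_real S) ev \<Longrightarrow> Re ev < 0"
    and "i < n" "j < n"
  shows "((\<lambda>x. G x $$ (i,j)) \<longlongrightarrow> 0) at_top"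
proof -
  define A where "A = map_mat complex_of_real S"
  have A: "A \<in> carrier_mat n n" using S by (simp add: A_def)
  obtain es where es: "char_poly A = (\<Prod>e \<leftarrow> es. [:- e, 1:])"
    using char_poly_factorized[OF A] by blast
  obtain B P Q where "schur_decomposition A es = (B,P,Q)" by (metis prod_cases3)
  from schur_decomposition[OF A es this]
  have wit: "similar_mat_wit A B P Q" and tri: "upper_triangular B" and dB: "diag_mat B = es" by auto
  note [simp] = similar_mat_witD2(4-7)[OF A wit]
  have PQ: "P * Q = 1\<^sub>m n" and QP: "Q * P = 1\<^sub>m n" and APBQ: "A = P * B * Q"
    by (fact similar_mat_witD2[OF A wit])+
  have AP: "A * P = P * B"
  proof -
    have "A * P = P * B * (Q * P)" unfolding APBQ
      by (rule assoc_mult_mat[of _ n n _ n _ n]) (auto intro: mult_carrier_mat[of _ n n _ n])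
    thus ?thesis using right_mult_one_mat[of "P * B" n n] by (simp add: QP mult_carrier_mat[of _ n n _ n])
  qed
  \<comment> \<open>The Schur form carries the roots \<open>es\<close> of the characteristic
    polynomial on its diagonal, so these entries are eigenvalues of \<open>A\<close>.\<close>
  have diag: "Re (B $$ (k,k)) < 0" if k: "k < n" for k
  proof -
    have "B $$ (k,k) \<in> set es" using k dB[symmetric] similar_mat_witD2(5)[OF A wit]
      by (auto simp: diag_mat_def)
    hence "poly (char_poly A) (B $$ (k,k)) = 0" unfolding es by (auto simp: poly_prod_list prod_list_zero_iff)
    thus ?thesis using ev eigenvalue_root_char_poly[OF A] by (auto simp: A_def)
  qed
  define g where "g l x = complex_of_real (G x $$ (i,l))" for l x
  have g': "(g l has_vector_derivative (\<Sum>m<n. g m x * A $$ (m,l))) (at x)" if "l < n" for l x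
  proof -
    have "(G x * S) $$ (i,l) = (\<Sum>m<n. G x $$ (i,m) * S $$ (m,l))"
      by (rule index_mult_mat_sum[OF G S \<open>i < n\<close> that])
    hence "complex_of_real ((G x * S) $$ (i,l)) = (\<Sum>m<n. g m x * A $$ (m,l))"
      using S that by (auto simp: g_def A_def intro!: sum.cong)
    moreover have "(g l has_vector_derivative complex_of_real ((G x * S) $$ (i,l))) (at x)"
      unfolding g_def
      using G'[OF \<open>i < n\<close> that, of x] by (simp add: has_vector_derivative_of_real)
    ultimately show ?thesis by simp
  qed
  define F where "F k x = (\<Sum>l<n. g l x * P $$ (l,k))" for k x
  have F0: "(F k \<longlongrightarrow> 0) at_top" if "k < n" for k
  proof (rule triangular_ode_tendsto_0[of n F "\<lambda>k j. B $$ (k,j)", OF _ _ diag \<open>k < n\<close>])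
    fix k x assume k: "k < n"
    have "(F k has_vector_derivative (\<Sum>l<n. (\<Sum>m<n. g m x * A $$ (m,l)) * P $$ (l,k))) (at x)"
      unfolding F_def
      by (intro has_vector_derivative_sum has_vector_derivative_mult_left g') auto
    also have "(\<Sum>l<n. (\<Sum>m<n. g m x * A $$ (m,l)) * P $$ (l,k)) = (\<Sum>m<n. g m x * (\<Sum>l<n. A $$ (m,l) * P $$ (l,k)))"
      unfolding sum_distrib_left sum_distrib_right by (subst sum.swap) (simp add: mult.assoc)
    also have "\<dots> = (\<Sum>m<n. g m x * (\<Sum>l<n. P $$ (m,l) * B $$ (l,k)))"
      using AP k by (intro sum.cong refl) (simp flip: index_mult_mat_sum[of _ n n _ n] add: A del: index_mult_mat)
    also have "\<dots> = (\<Sum>l<n. F l x * B $$ (l,k))"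
      unfolding F_def sum_distrib_left sum_distrib_right by (subst sum.swap) (simp add: mult.assoc)
    finally show "(F k has_vector_derivative (\<Sum>l<n. F l x * B $$ (l,k))) (at x)" .
  next
    show "B $$ (k,j) = 0" if "j < k" "k < n" for k j
      using upper_triangularD[OF tri that(1)] that similar_mat_witD2(5)[OF A wit] by auto
  qed
  have "g j x = (\<Sum>k<n. F k x * Q $$ (k,j))" for x
  proof -
    have "(\<Sum>k<n. F k x * Q $$ (k,j)) = (\<Sum>l<n. g l x * (\<Sum>k<n. P $$ (l,k) * Q $$ (k,j)))"
      unfolding F_def sum_distrib_left sum_distrib_right by (subst sum.swap) (simp add: mult.assoc)
    also have "\<dots> = (\<Sum>l<n. g l x * 1\<^sub>m n $$ (l,j))"
      using PQ \<open>j < n\<close> by (intro sum.cong refl) (simp flip: index_mult_mat_sum[of _ n n _ n] del: index_mult_mat)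
    also have "\<dots> = (\<Sum>l<n. if l = j then g l x else 0)"
      using \<open>j < n\<close> by (intro sum.cong) auto
    finally show ?thesis using \<open>j < n\<close> by simp
  qed
  moreover have "((\<lambda>x. \<Sum>k<n. F k x * Q $$ (k,j)) \<longlongrightarrow> 0) at_top"
    by (intro tendsto_null_sum tendsto_mult_left_zero F0) auto
  ultimately have "(g j \<longlongrightarrow> 0) at_top" by presburger
  hence "((\<lambda>x. Re (g j x)) \<longlongrightarrow> 0) at_top" using tendsto_Re[of "g j" 0] by simp
  thus ?thesis by (simp add: g_def)
qed

section \<open>The matrix exponential as an entrywise power series\<close>

lemma pow_mat_entry_bound:
  fixes T :: "real mat"
  assumes T: "T \<in> carrier_mat n n" and C: "\<And>i j. i < n \<Longrightarrow> j < n \<Longrightarrow> \<bar>T $$ (i,j)\<bar> \<le> C"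
    and "i < n" "j < n"
  shows "\<bar>(T ^\<^sub>m k) $$ (i,j)\<bar> \<le> (real n * C) ^ k"
  using \<open>j < n\<close>
proof (induction k arbitrary: j)
  case 0
  then show ?case using T \<open>i < n\<close> by auto
next
  case (Suc k)
  have nC: "0 \<le> (real n * C) ^ k" using C[OF \<open>i < n\<close> \<open>i < n\<close>] by (intro zero_le_power) auto
  have "\<bar>(T ^\<^sub>m Suc k) $$ (i,j)\<bar> = \<bar>\<Sum>l<n. (T ^\<^sub>m k) $$ (i,l) * T $$ (l,j)\<bar>"
    using index_mult_mat_sum[of "T ^\<^sub>m k" n n T n i j] T \<open>i < n\<close> Suc.prems by simp
  also have "\<dots> \<le> (\<Sum>l<n. (real n * C) ^ k * C)"
    by (rule order.trans[OF sum_abs], rule sum_mono)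
       (use Suc nC C in \<open>auto simp: abs_mult intro!: mult_mono\<close>)
  finally show ?case by (simp add: mult_ac)
qed

lemma smult_pow_mat:
  fixes T :: "real mat"
  assumes T: "T \<in> carrier_mat n n"
  shows "(x \<cdot>\<^sub>m T) ^\<^sub>m k = x ^ k \<cdot>\<^sub>m T ^\<^sub>m k"
proof (induction k)
  case 0
  then show ?case using T by (intro eq_matI) auto
next
  case (Suc k)
  have Tk: "T ^\<^sub>m k \<in> carrier_mat n n" using T by simp
  have "(x \<cdot>\<^sub>m T) ^\<^sub>m Suc k = (x ^ k \<cdot>\<^sub>m T ^\<^sub>m k) * (x \<cdot>\<^sub>m T)" using Suc by simp
  also have "\<dots> = x ^ Suc k \<cdot>\<^sub>m (T ^\<^sub>m k * T)"
    using T Tk by (intro eq_matI) (auto simp: mult_ac)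
  finally show ?case by simp
qed

lemma mat_exp_carrier [simp]: "T \<in> carrier_mat n n \<Longrightarrow> mat_exp (x \<cdot>\<^sub>m T) \<in> carrier_mat n n"
  by (auto simp: mat_exp_def)

lemma mat_exp_smult_index:
  assumes "T \<in> carrier_mat n n" "i < n" "j < n"
  shows "mat_exp (x \<cdot>\<^sub>m T) $$ (i,j) = (\<Sum>k. (T ^\<^sub>m k) $$ (i,j) / fact k * x ^ k)"
proof -
  have *: "dim_row (T ^\<^sub>m k) = n" "dim_col (T ^\<^sub>m k) = n" for k
    using carrier_matD[OF pow_carrier_mat[OF assms(1)]] by auto
  from assms show ?thesis
    by (simp add: mat_exp_def smult_pow_mat[OF assms(1)] * mult_ac)
qed

text \<open>Comparison with the exponential series at \<open>n * C * \<bar>x\<bar>\<close>, where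
  the sum \<open>C\<close> of all absolute values of entries serves as their common bound.\<close>

lemma summable_mat_exp:
  fixes T :: "real mat"
  assumes T: "T \<in> carrier_mat n n" and "i < n" "j < n"
  shows "summable (\<lambda>k. (T ^\<^sub>m k) $$ (i,j) / fact k * x ^ k)"
proof -
  define C where "C = (\<Sum>i<n. \<Sum>j<n. \<bar>T $$ (i,j)\<bar>)"
  have C: "\<bar>T $$ (i,j)\<bar> \<le> C" if "i < n" "j < n" for i j
    unfolding C_def using that
    by (intro order.trans[OF _ member_le_sum[of i]] member_le_sum[of j]) (auto intro: sum_nonneg)
  show ?thesis
  proof (rule summable_comparison_test)
    show "summable (\<lambda>k. inverse (fact k) * (real n * C * \<bar>x\<bar>) ^ k)"
      by (rule summable_exp)
    show "\<exists>N. \<forall>k\<ge>N. norm ((T ^\<^sub>m k) $$ (i,j) / fact k * x ^ k)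
        \<le> inverse (fact k) * (real n * C * \<bar>x\<bar>) ^ k"
      using pow_mat_entry_bound[OF T C \<open>i < n\<close> \<open>j < n\<close>]
      by (auto simp: abs_mult power_abs power_mult_distrib divide_simps intro!: mult_right_mono)
  qed
qed

text \<open>Termwise differentiation: in \<open>diffs\<close> the factor \<open>Suc k\<close>
  cancels against the factorial, and splitting off the last factor of
  \<open>T ^\<^sub>m Suc k\<close> leaves the series of the exponential times
  \<open>T\<close>.\<close>

lemma mat_exp_has_derivative:
  assumes T: "T \<in> carrier_mat n n" and i: "i < n" and j: "j < n"
  shows "((\<lambda>x. mat_exp (x \<cdot>\<^sub>m T) $$ (i,j)) has_real_derivative (mat_exp (x \<cdot>\<^sub>m T) * T) $$ (i,j)) (at x)"
proof -
  define c where "c l k = (T ^\<^sub>m k) $$ (i,l) / fact k" for l k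
  have sm: "summable (\<lambda>k. c l k * y ^ k)" if "l < n" for l y
    unfolding c_def by (rule summable_mat_exp[OF T i that])
  have diffs: "diffs (c j) k = (\<Sum>l<n. c l k * T $$ (l,j))" for k
  proof -
    have "(T ^\<^sub>m Suc k) $$ (i,j) = (\<Sum>l<n. (T ^\<^sub>m k) $$ (i,l) * T $$ (l,j))"
      using index_mult_mat_sum[of "T ^\<^sub>m k" n n T n i j] T i j by simp
    thus ?thesis
      by (simp add: diffs_def c_def sum_divide_distrib del: of_nat_Suc pow_mat.simps)
  qed
  have "(\<Sum>k. diffs (c j) k * x ^ k) = (\<Sum>k. \<Sum>l<n. c l k * x ^ k * T $$ (l,j))"
    by (simp add: diffs sum_distrib_left sum_distrib_right mult_ac)
  also have "\<dots> = (\<Sum>l<n. \<Sum>k. c l k * x ^ k * T $$ (l,j))"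
    by (rule suminf_sum) (auto intro!: summable_mult2 sm)
  also have "\<dots> = (\<Sum>l<n. (\<Sum>k. c l k * x ^ k) * T $$ (l,j))"
    by (intro sum.cong refl suminf_mult2[symmetric] sm) auto
  also have "\<dots> = (mat_exp (x \<cdot>\<^sub>m T) * T) $$ (i,j)"
    using index_mult_mat_sum[OF mat_exp_carrier[OF T] T i j] mat_exp_smult_index[OF T i]
    by (simp add: c_def)
  finally show ?thesis
    using termdiffs_strong_converges_everywhere[OF sm[OF j], of x]
    unfolding mat_exp_smult_index[OF T i j] c_def[of j, symmetric] by simp
qed

lemma decaying_semigroup_mat_exp:
  assumes T: "T \<in> carrier_mat n n"
    and ev: "\<And>ev. eigenvalue (map_mat complex_of_real T) ev \<Longrightarrow> Re ev < 0"
  shows "decaying_semigroup n T (\<lambda>x. mat_exp (x \<cdot>\<^sub>m T))"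
proof -
  have "mat_exp (0 \<cdot>\<^sub>m T) = 1\<^sub>m n"
  proof (rule eq_matI)
    fix i j assume "i < dim_row (1\<^sub>m n :: real mat)" "j < dim_col (1\<^sub>m n :: real mat)"
    thus "mat_exp (0 \<cdot>\<^sub>m T) $$ (i,j) = 1\<^sub>m n $$ (i,j)"
      using T mat_exp_smult_index[OF T, of i j 0] powser_zero[of "\<lambda>k. (T ^\<^sub>m k) $$ (i,j) / fact k"] by simp
  qed (use T in \<open>auto simp: mat_exp_def\<close>)
  thus ?thesis
    unfolding decaying_semigroup_def
    using T mat_exp_has_derivative[OF T]
    by (auto intro!: mat_ode_tendsto_0[OF T _ _ ev] simp del: index_mult_mat)
qed

section \<open>Bilinear forms in a decaying semigroup and inversion of its generator\<close>

context
  fixes n S G assumes G: "decaying_semigroup n S G"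
begin

lemma decaying_semigroupD:
  shows "S \<in> carrier_mat n n" "G x \<in> carrier_mat n n" "G 0 = 1\<^sub>m n"
    "i < n \<Longrightarrow> j < n \<Longrightarrow> ((\<lambda>x. G x $$ (i,j)) has_real_derivative (G x * S) $$ (i,j)) (at x)"
    "i < n \<Longrightarrow> j < n \<Longrightarrow> ((\<lambda>x. G x $$ (i,j)) \<longlongrightarrow> 0) at_top"
  using G by (auto simp: decaying_semigroup_def)

text \<open>Since \<open>G' = G S\<close>, differentiation replaces \<open>v\<close> by
  \<open>S *\<^sub>v v\<close>. To find an antiderivative of such a form it therefore suffices to
  solve a linear system with matrix \<open>S\<close>.\<close>

lemma decaying_semigroup_form_derivative:
  assumes a: "a \<in> carrier_vec n" and v: "v \<in> carrier_vec n"
  shows "((\<lambda>x. scalar_prod a (G x *\<^sub>v v)) has_real_derivative scalar_prod a (G x *\<^sub>v (S *\<^sub>v v))) (at x)"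
proof -
  have "G x * S \<in> carrier_mat n n" by (rule mult_carrier_mat[OF decaying_semigroupD(2,1)])
  hence "scalar_prod a (G x *\<^sub>v (S *\<^sub>v v)) =
      (\<Sum>i<n. \<Sum>j<n. vec_index a i * (G x * S) $$ (i,j) * vec_index v j)"
    unfolding assoc_mult_mat_vec[OF decaying_semigroupD(2,1) v, symmetric]
    by (rule scalar_prod_mult_mat_vec_sum[OF a _ v])
  thus ?thesis
    unfolding scalar_prod_mult_mat_vec_sum[OF a decaying_semigroupD(2) v]
    by (auto intro!: DERIV_sum DERIV_cmult_right DERIV_cmult decaying_semigroupD)
qed

lemma decaying_semigroup_form_tendsto_0:
  assumes a: "a \<in> carrier_vec n" and v: "v \<in> carrier_vec n"
  shows "((\<lambda>x. scalar_prod a (G x *\<^sub>v v)) \<longlongrightarrow> 0) at_top"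
  unfolding scalar_prod_mult_mat_vec_sum[OF a decaying_semigroupD(2) v]
  by (auto intro!: tendsto_null_sum tendsto_mult_left_zero tendsto_mult_right_zero decaying_semigroupD)

text \<open>A kernel vector \<open>v\<close> of \<open>S\<close> makes \<open>G x v\<close> constant in \<open>x\<close>, hence \<open>v = G 0 v\<close> equals the limit \<open>0\<close>.\<close>

lemma decaying_semigroup_det_nonzero: "det S \<noteq> 0"
proof
  assume "det S = 0"
  then obtain v where v: "v \<in> carrier_vec n" "v \<noteq> 0\<^sub>v n" "S *\<^sub>v v = 0\<^sub>v n"
    using det_0_iff_vec_prod_zero_field[OF decaying_semigroupD(1)] by blast
  have "vec_index v i = 0" if i: "i < n" for i
  proof -
    define f where "f x = scalar_prod (unit_vec n i) (G x *\<^sub>v v)" for x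
    have "(f has_real_derivative 0) (at x)" for x
    proof -
      have "G x *\<^sub>v 0\<^sub>v n = 0\<^sub>v n" using decaying_semigroupD(2)[of x] by (intro eq_vecI) auto
      thus ?thesis
        using decaying_semigroup_form_derivative[of "unit_vec n i" v x] v decaying_semigroupD(2)[of x]
        by (simp add: f_def[abs_def])
    qed
    hence "f = (\<lambda>_. f 0)" using DERIV_isconst_all by blast
    moreover have "(f \<longlongrightarrow> 0) at_top"
      unfolding f_def[abs_def] by (rule decaying_semigroup_form_tendsto_0) (use v in auto)
    ultimately have "f 0 = 0"
      using tendsto_unique[OF _ tendsto_const[of "f 0"]] by (metis trivial_limit_at_top_linorder)
    thus ?thesis using v i decaying_semigroupD(3) by (simp add: f_def)
  qed
  with v show False by (metis eq_vecI carrier_vecD index_zero_vec)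
qed

text \<open>A nonzero determinant makes \<open>- S\<close> a unit, so \<open>mat_inverse\<close>
  returns a \<open>Some\<close> and the \<open>the\<close> inside \<open>mat_inv\<close> yields a
  true inverse.\<close>

lemma decaying_semigroup_mat_inv:
  assumes "v \<in> carrier_vec n"
  shows "mat_inv (- S) \<in> carrier_mat n n" "S *\<^sub>v (mat_inv (- S) *\<^sub>v v) = - v"
proof -
  have S: "- S \<in> carrier_mat n n" using decaying_semigroupD(1) by auto
  have "det (- S) \<noteq> 0" using decaying_semigroup_det_nonzero decaying_semigroupD(1)
    by (simp add: det_0_negate)
  hence "- S \<in> Units (ring_mat TYPE(real) n ())" by (rule det_non_zero_imp_unit[OF S])
  with mat_inverse(1)[OF S, of "()"] obtain B where B: "mat_inverse (- S) = Some B" by (cases "mat_inverse (- S)") auto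
  from mat_inverse(2)[OF S B] have *: "- S * B = 1\<^sub>m n" "B \<in> carrier_mat n n" by auto
  thus Bc: "mat_inv (- S) \<in> carrier_mat n n" by (simp add: mat_inv_def B)
  have "- S *\<^sub>v (B *\<^sub>v v) = v"
    using assoc_mult_mat_vec[OF S *(2) assms] * assms by simp
  moreover have "S *\<^sub>v (B *\<^sub>v v) = - (- S *\<^sub>v (B *\<^sub>v v))"
    using decaying_semigroupD(1) *(2) assms by (simp add: uminus_mult_mat_vec)
  ultimately show "S *\<^sub>v (mat_inv (- S) *\<^sub>v v) = - v" by (simp add: mat_inv_def B)
qed

end

section \<open>Kronecker products\<close>

text \<open>The bijection \<open>k = a * m + b\<close> between indices and pairs. It separates the
  two factors of a Kronecker product in the three product rules below.\<close>

lemma sum_div_mod: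
  fixes f :: "nat \<Rightarrow> nat \<Rightarrow> 'a :: comm_monoid_add"
  shows "(\<Sum>k<n * m. f (k div m) (k mod m)) = (\<Sum>a<n. \<Sum>b<m. f a b)"
proof -
  have index_bound: "a * m + b < n * m" if "a < n" "b < m" for a b
    using mult_le_mono1[of "Suc a" n m] that by simp
  show ?thesis
    unfolding sum.cartesian_product
    by (rule sum.reindex_bij_witness[where i = "\<lambda>(a,b). a * m + b" and j = "\<lambda>k. (k div m, k mod m)"])
       (auto simp: less_mult_imp_div_less intro: index_bound intro!: mod_less_divisor gr0I)
qed

lemma kron_mat_carrier [simp]:
  "A \<in> carrier_mat n m \<Longrightarrow> B \<in> carrier_mat n' m' \<Longrightarrow> kron_mat A B \<in> carrier_mat (n * n') (m * m')"
  by (auto simp: kron_mat_def)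

lemma kron_vec_carrier [simp]:
  "a \<in> carrier_vec n \<Longrightarrow> b \<in> carrier_vec m \<Longrightarrow> kron_vec a b \<in> carrier_vec (n * m)"
  by (auto simp: kron_vec_def)

lemma kron_sum_carrier [simp]:
  "A \<in> carrier_mat n n \<Longrightarrow> B \<in> carrier_mat m m \<Longrightarrow> kron_sum A B \<in> carrier_mat (n * m) (n * m)"
  by (auto simp: kron_sum_def kron_mat_def)

lemma kron_mat_index:
  assumes "A \<in> carrier_mat n m" "B \<in> carrier_mat n' m'" "i < n * n'" "j < m * m'"
  shows "kron_mat A B $$ (i,j) = A $$ (i div n', j div m') * B $$ (i mod n', j mod m')"
  using assms by (auto simp: kron_mat_def)

lemma div_mod_less:
  assumes "i < n * (m :: nat)"
  shows "i div m < n" "i mod m < m"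
  using assms by (auto simp: less_mult_imp_div_less intro!: mod_less_divisor gr0I)

text \<open>The mixed-product rule: the summation index splits into quotient and remainder, and the
  double sum factors into the two ordinary matrix products.\<close>

lemma kron_mat_mult:
  assumes A: "A \<in> carrier_mat n m" and B: "B \<in> carrier_mat n' m'"
    and C: "C \<in> carrier_mat m k" and D: "D \<in> carrier_mat m' k'"
  shows "kron_mat A B * kron_mat C D = kron_mat (A * C) (B * D)"
proof (rule eq_matI)
  note car = kron_mat_carrier[OF A B] kron_mat_carrier[OF C D]
    mult_carrier_mat[OF A C] mult_carrier_mat[OF B D]
  fix i j assume "i < dim_row (kron_mat (A * C) (B * D))" "j < dim_col (kron_mat (A * C) (B * D))"
  hence i: "i < n * n'" and j: "j < k * k'" using A B C D by (auto simp: kron_mat_def)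
  note i' = div_mod_less[OF i] and j' = div_mod_less[OF j]
  have "(kron_mat A B * kron_mat C D) $$ (i,j) = (\<Sum>l<m * m'. kron_mat A B $$ (i,l) * kron_mat C D $$ (l,j))"
    by (rule index_mult_mat_sum[OF car(1,2) i j])
  also have "\<dots> = (\<Sum>l<m * m'. (A $$ (i div n', l div m') * B $$ (i mod n', l mod m'))
                 * (C $$ (l div m', j div k') * D $$ (l mod m', j mod k')))"
    using i j by (intro sum.cong refl) (simp add: kron_mat_index[OF A B] kron_mat_index[OF C D])
  also have "\<dots> = (\<Sum>a<m. \<Sum>b<m'. (A $$ (i div n', a) * B $$ (i mod n', b)) * (C $$ (a, j div k') * D $$ (b, j mod k')))"
    by (rule sum_div_mod)
  also have "\<dots> = (A * C) $$ (i div n', j div k') * (B * D) $$ (i mod n', j mod k')"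
    unfolding index_mult_mat_sum[OF A C i'(1) j'(1)] index_mult_mat_sum[OF B D i'(2) j'(2)] sum_product
    by (simp add: mult_ac)
  also have "\<dots> = kron_mat (A * C) (B * D) $$ (i,j)"
    by (rule kron_mat_index[OF car(3,4) i j, symmetric])
  finally show "(kron_mat A B * kron_mat C D) $$ (i,j) = kron_mat (A * C) (B * D) $$ (i,j)" .
qed (use assms in \<open>auto simp: kron_mat_def\<close>)

lemma kron_mat_mult_vec:
  assumes A: "A \<in> carrier_mat n m" and B: "B \<in> carrier_mat n' m'"
    and a: "a \<in> carrier_vec m" and b: "b \<in> carrier_vec m'"
  shows "kron_mat A B *\<^sub>v kron_vec a b = kron_vec (A *\<^sub>v a) (B *\<^sub>v b)"
proof (rule eq_vecI)
  fix i assume "i < dim_vec (kron_vec (A *\<^sub>v a) (B *\<^sub>v b))"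
  hence i: "i < n * n'" using A B by (auto simp: kron_vec_def)
  note i' = div_mod_less[OF i]
  have "vec_index (kron_mat A B *\<^sub>v kron_vec a b) i =
      (\<Sum>l<m * m'. (A $$ (i div n', l div m') * B $$ (i mod n', l mod m'))
         * (vec_index a (l div m') * vec_index b (l mod m')))"
    using i A B a b by (auto simp: scalar_prod_def kron_mat_def kron_vec_def lessThan_atLeast0)
  also have "\<dots> = (\<Sum>c<m. \<Sum>d<m'. (A $$ (i div n', c) * B $$ (i mod n', d)) * (vec_index a c * vec_index b d))"
    by (rule sum_div_mod)
  also have "\<dots> = (\<Sum>c<m. A $$ (i div n', c) * vec_index a c) * (\<Sum>d<m'. B $$ (i mod n', d) * vec_index b d)"
    unfolding sum_product by (simp add: mult_ac)
  also have "\<dots> = vec_index (kron_vec (A *\<^sub>v a) (B *\<^sub>v b)) i"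
    using i i' A B a b by (auto simp: scalar_prod_def kron_vec_def lessThan_atLeast0)
  finally show "vec_index (kron_mat A B *\<^sub>v kron_vec a b) i = vec_index (kron_vec (A *\<^sub>v a) (B *\<^sub>v b)) i" .
qed (use assms in \<open>auto simp: kron_mat_def kron_vec_def\<close>)

lemma kron_vec_scalar_prod:
  assumes a: "a \<in> carrier_vec n" and b: "b \<in> carrier_vec m"
    and c: "c \<in> carrier_vec n" and d: "d \<in> carrier_vec m"
  shows "scalar_prod (kron_vec a b) (kron_vec c d) = scalar_prod a c * scalar_prod b d"
proof -
  have "scalar_prod (kron_vec a b) (kron_vec c d) =
      (\<Sum>l<n * m. (vec_index a (l div m) * vec_index b (l mod m)) * (vec_index c (l div m) * vec_index d (l mod m)))"
    using assms by (auto simp: scalar_prod_def kron_vec_def lessThan_atLeast0)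
  also have "\<dots> = (\<Sum>i<n. \<Sum>j<m. (vec_index a i * vec_index b j) * (vec_index c i * vec_index d j))"
    by (rule sum_div_mod)
  also have "\<dots> = scalar_prod a c * scalar_prod b d"
    using c d by (simp add: scalar_prod_def sum_product mult_ac flip: lessThan_atLeast0)
  finally show ?thesis .
qed

text \<open>The Leibniz rule in each entry matches \<open>(G \<otimes> H) (S \<otimes> I + I
  \<otimes> R) = G S \<otimes> H + G \<otimes> H R\<close>, which is the mixed-product rule. Each
  entry is a product of two entries that tend to 0.\<close>

lemma decaying_semigroup_kron:
  assumes 1: "decaying_semigroup n S G" and 2: "decaying_semigroup m R H"
  shows "decaying_semigroup (n * m) (kron_sum S R) (\<lambda>x. kron_mat (G x) (H x))"
proof -
  note S = decaying_semigroupD[OF 1] and R = decaying_semigroupD[OF 2]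
  note car [simp] = S(1,2) R(1,2)
  have dims: "dim_row S = n" "dim_row R = m" using car(1,3) by blast+
  \<comment> \<open>Quotient and remainder together determine the index, so a Kronecker product of
    identities has its ones exactly on the diagonal.\<close>
  have eq1: "i div m = j div m \<and> i mod m = j mod m \<longleftrightarrow> i = j" for i j
    by (metis div_mult_mod_eq)
  have "kron_mat (1\<^sub>m n) (1\<^sub>m m) = 1\<^sub>m (n * m)"
  proof (rule eq_matI)
    fix i j assume "i < dim_row (1\<^sub>m (n * m) :: real mat)" "j < dim_col (1\<^sub>m (n * m) :: real mat)"
    hence i: "i < n * m" and j: "j < n * m" by auto
    show "kron_mat (1\<^sub>m n) (1\<^sub>m m) $$ (i,j) = 1\<^sub>m (n * m) $$ (i,j)"
      using i j div_mod_less[OF i] div_mod_less[OF j] eq1[of i j]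
      by (auto simp: kron_mat_index[of _ n n _ m m])
  qed (auto simp: kron_mat_def)
  moreover have "((\<lambda>x. kron_mat (G x) (H x) $$ (i,j)) has_real_derivative
      (kron_mat (G x) (H x) * kron_sum S R) $$ (i,j)) (at x)"
    if i: "i < n * m" and j: "j < n * m" for i j x
  proof -
    note i' = div_mod_less[OF i] and j' = div_mod_less[OF j]
    have GS: "G x * S \<in> carrier_mat n n" and HR: "H x * R \<in> carrier_mat m m"
      by (auto intro: mult_carrier_mat[of _ _ n] mult_carrier_mat[of _ _ m])
    have "kron_mat (G x) (H x) * kron_sum S R =
        kron_mat (G x) (H x) * kron_mat S (1\<^sub>m m) + kron_mat (G x) (H x) * kron_mat (1\<^sub>m n) R"
      unfolding kron_sum_def dims
      by (rule mult_add_distrib_mat[of _ "n * m" "n * m" _ "n * m"]) auto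
    also have "\<dots> = kron_mat (G x * S) (H x) + kron_mat (G x) (H x * R)"
      using kron_mat_mult[of "G x" n n "H x" m m S n "1\<^sub>m m" m]
        kron_mat_mult[of "G x" n n "H x" m m "1\<^sub>m n" n R m]
        right_mult_one_mat[OF S(2)] right_mult_one_mat[OF R(2)] by simp
    finally have eq: "(kron_mat (G x) (H x) * kron_sum S R) $$ (i,j) =
        (G x * S) $$ (i div m, j div m) * H x $$ (i mod m, j mod m) +
        G x $$ (i div m, j div m) * (H x * R) $$ (i mod m, j mod m)"
      using i j carrier_matD[OF kron_mat_carrier[OF S(2) HR]]
      by (simp add: kron_mat_index[OF GS R(2)] kron_mat_index[OF S(2) HR])
    show ?thesis
      unfolding eq kron_mat_index[OF S(2) R(2) i j]
      by (rule DERIV_cong[OF DERIV_mult[OF S(4)[OF i'(1) j'(1)] R(4)[OF i'(2) j'(2)]]]) (simp add: mult_ac)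
  qed
  moreover have "((\<lambda>x. kron_mat (G x) (H x) $$ (i,j)) \<longlongrightarrow> 0) at_top"
    if i: "i < n * m" and j: "j < n * m" for i j
    unfolding kron_mat_index[OF S(2) R(2) i j]
    using div_mod_less[OF i] div_mod_less[OF j]
    by (intro tendsto_mult_zero S(5) R(5))
  ultimately show ?thesis
    unfolding decaying_semigroup_def by (simp add: S(3) R(3) del: index_mult_mat)
qed

section \<open>Matrix-exponential densities\<close>

lemma ME_semigroup:
  assumes "ME_triple n \<alpha> T t"
  shows "decaying_semigroup n T (\<lambda>x. mat_exp (x \<cdot>\<^sub>m T))"
  using assms by (intro decaying_semigroup_mat_exp) (auto simp: ME_triple_def)

lemma ME_l_carrier:
  assumes "ME_triple n \<alpha> T t"
  shows "ME_l T t \<in> carrier_vec n" "T *\<^sub>v ME_l T t = - t"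
  using decaying_semigroup_mat_inv[OF ME_semigroup[OF assms], of t] assms
  by (auto simp: ME_l_def ME_triple_def)

lemma ME_fun_DERIV:
  assumes ME: "ME_triple n \<alpha> T t" and v: "v \<in> carrier_vec n"
  shows "(ME_fun \<alpha> T v has_real_derivative ME_fun \<alpha> T (T *\<^sub>v v) x) (at x)"
  unfolding ME_fun_def[abs_def]
  using decaying_semigroup_form_derivative[OF ME_semigroup[OF ME] _ v] ME by (auto simp: ME_triple_def)

lemma ME_fun_measurable:
  assumes ME: "ME_triple n \<alpha> T t" and v: "v \<in> carrier_vec n"
  shows "ME_fun \<alpha> T v \<in> borel_measurable borel"
  using ME_fun_DERIV[OF ME v]
  by (intro borel_measurable_continuous_onI) (auto intro!: DERIV_isCont continuous_at_imp_continuous_on)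

text \<open>The function \<open>ME_fun \<alpha> T (ME_l T t)\<close> is the survival function of the density
  \<open>ME_fun \<alpha> T t\<close>.\<close>

lemma ME_survival_DERIV:
  assumes ME: "ME_triple n \<alpha> T t"
  shows "(ME_fun \<alpha> T (ME_l T t) has_real_derivative - ME_fun \<alpha> T t x) (at x)"
proof -
  note G = ME_semigroup[OF ME]
  have \<alpha>: "\<alpha> \<in> carrier_vec n" and t: "t \<in> carrier_vec n" using ME by (auto simp: ME_triple_def)
  have "mat_exp (x \<cdot>\<^sub>m T) *\<^sub>v (- t) = - (mat_exp (x \<cdot>\<^sub>m T) *\<^sub>v t)"
    using decaying_semigroupD(2)[OF G, of x] t by (intro eq_vecI) auto
  hence "scalar_prod \<alpha> (mat_exp (x \<cdot>\<^sub>m T) *\<^sub>v (T *\<^sub>v ME_l T t)) = - ME_fun \<alpha> T t x"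
    using decaying_semigroupD(2)[OF G, of x] t \<alpha> by (simp add: ME_l_carrier[OF ME] ME_fun_def)
  with decaying_semigroup_form_derivative[OF G \<alpha> ME_l_carrier(1)[OF ME], of x] show ?thesis
    by (simp add: ME_fun_def[abs_def])
qed

lemma ME_survival_tendsto_0:
  assumes ME: "ME_triple n \<alpha> T t"
  shows "(ME_fun \<alpha> T (ME_l T t) \<longlongrightarrow> 0) at_top"
  using decaying_semigroup_form_tendsto_0[OF ME_semigroup[OF ME] _ ME_l_carrier(1)[OF ME], of \<alpha>] ME
  by (simp add: ME_triple_def ME_fun_def[abs_def])

text \<open>From \<open>a\<close> on, \<open>F\<close> is nonincreasing, so \<open>F a\<close> is an
  upper bound for the limit 0.\<close>

lemma DERIV_nonpos_tendsto_0_imp_nonneg: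
  fixes f F :: "real \<Rightarrow> real"
  assumes F': "\<And>x. a \<le> x \<Longrightarrow> (F has_real_derivative - f x) (at x)"
    and nonneg: "\<And>x. a \<le> x \<Longrightarrow> 0 \<le> f x"
    and lim: "(F \<longlongrightarrow> 0) at_top"
  shows "F a \<ge> 0"
proof (rule tendsto_upperbound[OF lim])
  show "\<forall>\<^sub>F y in at_top. F y \<le> F a"
    using eventually_ge_at_top[of a]
  proof eventually_elim
    case (elim y)
    show ?case
      using F' nonneg by (intro DERIV_nonpos_imp_nonincreasing[OF elim]) (metis neg_le_0_iff_le)
  qed
qed auto

lemma ME_survival_nonneg:
  assumes ME: "ME_triple n \<alpha> T t" and x: "x \<ge> 0"
  shows "ME_fun \<alpha> T (ME_l T t) x \<ge> 0"
  using ME x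
  by (intro DERIV_nonpos_tendsto_0_imp_nonneg[OF ME_survival_DERIV[OF ME] _ ME_survival_tendsto_0[OF ME]])
     (auto simp: ME_triple_def)

text \<open>The fundamental theorem for the antiderivative \<open>- F\<close>, whose limit at
  infinity is 0. The value is first found as a nonnegative integral and then transferred.\<close>

lemma has_bochner_integral_FTC_atLeast:
  fixes f F :: "real \<Rightarrow> real"
  assumes f: "f \<in> borel_measurable borel"
    and "\<And>x. a \<le> x \<Longrightarrow> (F has_real_derivative - f x) (at x)"
    and nonneg: "\<And>x. a \<le> x \<Longrightarrow> 0 \<le> f x"
    and lim: "(F \<longlongrightarrow> 0) at_top"
  shows "has_bochner_integral lborel (\<lambda>x. f x * indicator {a..} x) (F a)"
proof -
  have "(\<integral>\<^sup>+x. ennreal (f x) * indicator {a..} x \<partial>lborel) = ennreal (0 - (- F a))"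
    using assms by (intro nn_integral_FTC_atLeast) (auto intro!: derivative_eq_intros tendsto_eq_intros)
  hence nn: "(\<integral>\<^sup>+x. ennreal (f x * indicator {a..} x) \<partial>lborel) = ennreal (F a)"
    by (simp add: ennreal_mult'' ennreal_indicator)
  \<comment> \<open>\<open>ennreal\<close> sends negative reals to 0, so the sign of
    \<open>F a\<close> is needed to read the value back as a real number.\<close>
  have "F a \<ge> 0"
    by (rule DERIV_nonpos_tendsto_0_imp_nonneg[OF assms(2) nonneg lim])
  with nn show ?thesis
    using f nonneg by (intro has_bochner_integral_nn_integral) (auto simp: indicator_def)
qed

section \<open>Densities and distribution functions on the whole line\<close>

definition ME_density :: "real vec \<Rightarrow> real mat \<Rightarrow> real vec \<Rightarrow> real \<Rightarrow> real" where
  "ME_density \<alpha> T t x = ME_fun \<alpha> T t x * indicator {0..} x"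

text \<open>Given through the closed form of the survival function;
  \<open>ME_density_lessThan_integral\<close> identifies it with the integral of the
  density.\<close>

definition ME_cdf :: "real vec \<Rightarrow> real mat \<Rightarrow> real vec \<Rightarrow> real \<Rightarrow> real" where
  "ME_cdf \<alpha> T t x = (if x \<ge> 0 then 1 - ME_fun \<alpha> T (ME_l T t) x else 0)"

lemma ME_tail_integral:
  assumes ME: "ME_triple n \<alpha> T t" and y: "y \<ge> 0"
  shows "has_bochner_integral lborel (\<lambda>x. ME_fun \<alpha> T t x * indicator {y..} x) (ME_fun \<alpha> T (ME_l T t) y)"
  using ME y ME_survival_DERIV[OF ME] ME_survival_tendsto_0[OF ME] ME_fun_measurable[OF ME, of t]
  by (intro has_bochner_integral_FTC_atLeast) (auto simp: ME_triple_def)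

text \<open>The integral of the density over \<open>[0, \<infinity>)\<close> is evaluated twice: by
  the tail formula at 0, and as 1 by the normalization in \<open>ME_triple\<close>.\<close>

lemma ME_survival_0:
  assumes ME: "ME_triple n \<alpha> T t"
  shows "ME_fun \<alpha> T (ME_l T t) 0 = 1"
proof -
  have "((\<lambda>x. ME_fun \<alpha> T t x * indicator {0..} x) has_integral ME_fun \<alpha> T (ME_l T t) 0) UNIV"
    using ME_tail_integral[OF ME order.refl] has_integral_integral_real
    unfolding has_bochner_integral_iff by metis
  moreover have "(\<lambda>x. ME_fun \<alpha> T t x * indicator {0..} x) = (\<lambda>x. if x \<in> {0..} then ME_fun \<alpha> T t x else 0)"
    by (auto simp: indicator_def)
  ultimately have "(ME_fun \<alpha> T t has_integral ME_fun \<alpha> T (ME_l T t) 0) {0..}"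
    by (simp only: has_integral_restrict_UNIV)
  thus ?thesis using ME by (auto simp: ME_triple_def intro: has_integral_unique)
qed

lemma ME_density_integral:
  assumes ME: "ME_triple n \<alpha> T t"
  shows "has_bochner_integral lborel (ME_density \<alpha> T t) 1"
  using ME_tail_integral[OF ME, of 0] by (simp add: ME_survival_0[OF ME] ME_density_def[abs_def])

text \<open>For \<open>y \<ge> 0\<close> this is the total mass minus the tail from
  \<open>y\<close>; for \<open>y < 0\<close> the density vanishes on the half-line. The endpoint is
  excluded to match the strict inequalities of concordance.\<close>

lemma ME_density_lessThan_integral:
  assumes ME: "ME_triple n \<alpha> T t"
  shows "has_bochner_integral lborel (\<lambda>x. indicator {..<y} x * ME_density \<alpha> T t x) (ME_cdf \<alpha> T t y)"
proof (cases "y \<ge> 0")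
  case True
  have "has_bochner_integral lborel (\<lambda>x. ME_density \<alpha> T t x - ME_fun \<alpha> T t x * indicator {y..} x)
      (1 - ME_fun \<alpha> T (ME_l T t) y)"
    by (intro has_bochner_integral_diff ME_density_integral[OF ME] ME_tail_integral[OF ME True])
  moreover have "(\<lambda>x. ME_density \<alpha> T t x - ME_fun \<alpha> T t x * indicator {y..} x) =
      (\<lambda>x. indicator {..<y} x * ME_density \<alpha> T t x)"
    using True by (auto simp: ME_density_def indicator_def)
  ultimately show ?thesis using True by (simp add: ME_cdf_def)
next
  case False
  hence "(\<lambda>x. indicator {..<y} x * ME_density \<alpha> T t x) = (\<lambda>_. 0)"
    by (auto simp: ME_density_def indicator_def)
  with False show ?thesis by (simp add: ME_cdf_def has_bochner_integral_zero)
qed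

lemma ME_cdf_range:
  assumes ME: "ME_triple n \<alpha> T t"
  shows "ME_cdf \<alpha> T t y \<in> {0..1}"
proof -
  have nonneg: "ME_density \<alpha> T t x \<ge> 0" for x
    using ME by (auto simp: ME_triple_def ME_density_def indicator_def)
  have "0 \<le> ME_cdf \<alpha> T t y"
    unfolding has_bochner_integral_integral_eq[OF ME_density_lessThan_integral[OF ME, of y], symmetric]
    by (rule Bochner_Integration.integral_nonneg) (simp add: nonneg)
  moreover have "ME_cdf \<alpha> T t y \<le> 1"
    using ME_survival_nonneg[OF ME, of y] by (simp add: ME_cdf_def)
  ultimately show ?thesis by simp
qed

lemma ME_cdf_measurable:
  assumes ME: "ME_triple n \<alpha> T t"
  shows "ME_cdf \<alpha> T t \<in> borel_measurable borel"
proof -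
  have [measurable]: "ME_fun \<alpha> T (ME_l T t) \<in> borel_measurable borel"
    by (rule ME_fun_measurable[OF ME ME_l_carrier(1)[OF ME]])
  show ?thesis unfolding ME_cdf_def[abs_def] by measurable
qed

text \<open>The antiderivative of the survival function of the first density times the second density
  comes from the matrix exponential of the Kronecker sum.\<close>

lemma ME_cdf_density_integral:
  assumes ME: "ME_triple n \<alpha> T t" and ME': "ME_triple n' \<alpha>' T' t'"
  shows "has_bochner_integral lborel (\<lambda>x. ME_cdf \<alpha> T t x * ME_density \<alpha>' T' t' x)
    (1 - scalar_prod (kron_vec \<alpha> \<alpha>') (mat_inv (- kron_sum T T') *\<^sub>v kron_vec (ME_l T t) t'))"
proof -
  define G where "G x = kron_mat (mat_exp (x \<cdot>\<^sub>m T)) (mat_exp (x \<cdot>\<^sub>m T'))" for x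
  define v where "v = kron_vec (ME_l T t) t'"
  \<comment> \<open>\<open>w\<close> solves \<open>kron_sum T T' *\<^sub>v w = - v\<close>, so the
    derivative of \<open>F\<close> is minus the survival function of the first density times the
    second density.\<close>
  define w where "w = mat_inv (- kron_sum T T') *\<^sub>v v"
  define F where "F x = scalar_prod (kron_vec \<alpha> \<alpha>') (G x *\<^sub>v w)" for x
  have car: "\<alpha> \<in> carrier_vec n" "t \<in> carrier_vec n" "\<alpha>' \<in> carrier_vec n'" "t' \<in> carrier_vec n'"
    using ME ME' by (auto simp: ME_triple_def)
  note l = ME_l_carrier(1)[OF ME]
  note E = decaying_semigroupD(2)[OF ME_semigroup[OF ME]] and E' = decaying_semigroupD(2)[OF ME_semigroup[OF ME']]
  have G: "decaying_semigroup (n * n') (kron_sum T T') G"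
    unfolding G_def[abs_def] by (rule decaying_semigroup_kron[OF ME_semigroup[OF ME] ME_semigroup[OF ME']])
  note GD = decaying_semigroupD[OF G]
  have v: "v \<in> carrier_vec (n * n')" using l car by (simp add: v_def)
  have k: "kron_vec \<alpha> \<alpha>' \<in> carrier_vec (n * n')" using car by simp
  note inv = decaying_semigroup_mat_inv[OF G v, folded w_def]
  have w: "w \<in> carrier_vec (n * n')" unfolding w_def by (rule mult_mat_vec_carrier[OF inv(1) v])
  have F': "(F has_real_derivative - (ME_fun \<alpha> T (ME_l T t) x * ME_fun \<alpha>' T' t' x)) (at x)" for x
  proof -
    have "G x *\<^sub>v (- v) = - (G x *\<^sub>v v)"
      using GD(2)[of x] v by (intro eq_vecI) auto
    hence "scalar_prod (kron_vec \<alpha> \<alpha>') (G x *\<^sub>v (kron_sum T T' *\<^sub>v w)) = - scalar_prod (kron_vec \<alpha> \<alpha>') (G x *\<^sub>v v)"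
      using k GD(2)[of x] v by (simp add: inv(2))
    also have "G x *\<^sub>v v = kron_vec (mat_exp (x \<cdot>\<^sub>m T) *\<^sub>v ME_l T t) (mat_exp (x \<cdot>\<^sub>m T') *\<^sub>v t')"
      unfolding G_def v_def by (rule kron_mat_mult_vec[OF E E' l car(4)])
    also have "scalar_prod (kron_vec \<alpha> \<alpha>') \<dots> = ME_fun \<alpha> T (ME_l T t) x * ME_fun \<alpha>' T' t' x"
      unfolding ME_fun_def
      by (rule kron_vec_scalar_prod) (use l car mult_mat_vec_carrier[OF E l] mult_mat_vec_carrier[OF E' car(4)] in auto)
    finally show ?thesis
      using decaying_semigroup_form_derivative[OF G k w, of x] by (simp add: F_def[abs_def])
  qed
  have nonneg: "0 \<le> ME_fun \<alpha> T (ME_l T t) x * ME_fun \<alpha>' T' t' x" if "0 \<le> x" for x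
    using ME' that ME_survival_nonneg[OF ME that] by (auto simp: ME_triple_def)
  have [measurable]: "ME_fun \<alpha> T (ME_l T t) \<in> borel_measurable borel"
    by (rule ME_fun_measurable[OF ME ME_l_carrier(1)[OF ME]])
  note [measurable] = ME_fun_measurable[OF ME' car(4)]
  have "has_bochner_integral lborel
      (\<lambda>x. (ME_fun \<alpha> T (ME_l T t) x * ME_fun \<alpha>' T' t' x) * indicator {0..} x) (F 0)"
  proof (rule has_bochner_integral_FTC_atLeast[OF _ F' nonneg])
    show "(F \<longlongrightarrow> 0) at_top"
      unfolding F_def[abs_def] by (rule decaying_semigroup_form_tendsto_0[OF G k w])
  qed auto
  \<comment> \<open>On \<open>[0, \<infinity>)\<close> the distribution function is 1 minus the
    survival function, so the integral sought is the total mass 1 minus \<open>F 0\<close>.\<close>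
  from has_bochner_integral_diff[OF ME_density_integral[OF ME'] this]
  have "has_bochner_integral lborel (\<lambda>x. ME_density \<alpha>' T' t' x -
      (ME_fun \<alpha> T (ME_l T t) x * ME_fun \<alpha>' T' t' x) * indicator {0..} x) (1 - F 0)" .
  also have "(\<lambda>x. ME_density \<alpha>' T' t' x - (ME_fun \<alpha> T (ME_l T t) x * ME_fun \<alpha>' T' t' x) * indicator {0..} x) =
      (\<lambda>x. ME_cdf \<alpha> T t x * ME_density \<alpha>' T' t' x)"
    by (auto simp: ME_density_def ME_cdf_def indicator_def algebra_simps)
  also have "F 0 = scalar_prod (kron_vec \<alpha> \<alpha>') w"
    using w by (simp add: F_def GD(3))
  finally show ?thesis unfolding w_def v_def .
qed

section \<open>Kendall's tau\<close>

text \<open>Up to null sets, two copies are concordant in one of two symmetric ways,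
  \<open>lt\<close> or \<open>gt\<close>, or else discordant. With \<open>I\<close> the mean mass of
  the open quadrant below a random point, concordance has probability \<open>2 I\<close>, and tau is
  \<open>2 I - (1 - 2 I)\<close>.\<close>

lemma kendall_tau_no_ties:
  assumes "prob_space \<mu>" and sets: "sets \<mu> = sets (borel \<Otimes>\<^sub>M borel)"
    and fst: "\<And>y. measure \<mu> {q. fst q = y} = 0" and snd: "\<And>z. measure \<mu> {q. snd q = z} = 0"
  shows "kendall_tau \<mu> = 4 * (\<integral>q. measure \<mu> ({..<fst q} \<times> {..<snd q}) \<partial>\<mu>) - 1"
proof -
  interpret \<mu>: prob_space \<mu> by fact
  interpret pair_prob_space \<mu> \<mu> ..
  have space: "space \<mu> = UNIV" using sets_eq_imp_space_eq[OF sets] by (simp add: space_pair_measure)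
  note [measurable_cong] = sets
  let ?N = "\<mu> \<Otimes>\<^sub>M \<mu>"
  have sN: "space ?N = UNIV" by (simp add: space_pair_measure space)
  define lt :: "((real \<times> real) \<times> real \<times> real) set"
    where "lt = {q. fst (fst q) < fst (snd q) \<and> snd (fst q) < snd (snd q)}"
  define gt :: "((real \<times> real) \<times> real \<times> real) set"
    where "gt = {q. fst (snd q) < fst (fst q) \<and> snd (snd q) < snd (fst q)}"
  define disc :: "((real \<times> real) \<times> real \<times> real) set"
    where "disc = {q. (fst (fst q) - fst (snd q)) * (snd (fst q) - snd (snd q)) < 0}"
  define tie1 :: "((real \<times> real) \<times> real \<times> real) set" where "tie1 = {q. fst (fst q) = fst (snd q)}"
  define tie2 :: "((real \<times> real) \<times> real \<times> real) set" where "tie2 = {q. snd (fst q) = snd (snd q)}"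
  have M: "lt \<in> sets ?N" "gt \<in> sets ?N" "disc \<in> sets ?N" "tie1 \<in> sets ?N" "tie2 \<in> sets ?N"
  proof -
    have "{q \<in> space ?N. fst (fst q) < fst (snd q) \<and> snd (fst q) < snd (snd q)} \<in> sets ?N" by measurable
    thus "lt \<in> sets ?N" by (simp add: lt_def sN)
    have "{q \<in> space ?N. fst (snd q) < fst (fst q) \<and> snd (snd q) < snd (fst q)} \<in> sets ?N" by measurable
    thus "gt \<in> sets ?N" by (simp add: gt_def sN)
    have "{q \<in> space ?N. (fst (fst q) - fst (snd q)) * (snd (fst q) - snd (snd q)) < 0} \<in> sets ?N" by measurable
    thus "disc \<in> sets ?N" by (simp add: disc_def sN)
    have "{q \<in> space ?N. fst (fst q) = fst (snd q)} \<in> sets ?N" by measurable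
    thus "tie1 \<in> sets ?N" by (simp add: tie1_def sN)
    have "{q \<in> space ?N. snd (fst q) = snd (snd q)} \<in> sets ?N" by measurable
    thus "tie2 \<in> sets ?N" by (simp add: tie2_def sN)
  qed
  \<comment> \<open>The quadrant below \<open>q\<close> is the slice of \<open>lt\<close> at
    \<open>q\<close>, and slice measures are measurable.\<close>
  have box: "(\<lambda>q. measure \<mu> ({..<fst q} \<times> {..<snd q})) \<in> borel_measurable \<mu>"
  proof -
    have "(\<lambda>q. measure \<mu> ((\<lambda>p. (p, q)) -` lt)) \<in> borel_measurable \<mu>"
      using measurable_emeasure_Pair2[OF M(1)] unfolding measure_def by measurable
    moreover have "(\<lambda>p. (p, q)) -` lt = {..<fst q} \<times> {..<snd q}" for q by (auto simp: lt_def)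
    ultimately show ?thesis by simp
  qed
  have intbox: "integrable \<mu> (\<lambda>q. measure \<mu> ({..<fst q} \<times> {..<snd q}))"
    by (rule \<mu>.integrable_const_bound[of _ 1]) (use box in \<open>auto intro: \<mu>.prob_le_1\<close>)
  \<comment> \<open>\<open>lt\<close> is sliced at the second copy and \<open>gt\<close> at the
    first. Both slices are the open quadrant below the fixed point, so both events get the same
    integral.\<close>
  have "emeasure ?N lt = (\<integral>\<^sup>+q. emeasure \<mu> ({..<fst q} \<times> {..<snd q}) \<partial>\<mu>)"
    unfolding emeasure_pair_measure_alt2[OF M(1)]
    by (intro nn_integral_cong arg_cong[where f = "emeasure \<mu>"]) (auto simp: lt_def)
  moreover have "emeasure ?N gt = (\<integral>\<^sup>+q. emeasure \<mu> ({..<fst q} \<times> {..<snd q}) \<partial>\<mu>)"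
    unfolding \<mu>.emeasure_pair_measure_alt[OF M(2)]
    by (intro nn_integral_cong arg_cong[where f = "emeasure \<mu>"]) (auto simp: gt_def)
  moreover have "(\<integral>\<^sup>+q. emeasure \<mu> ({..<fst q} \<times> {..<snd q}) \<partial>\<mu>) =
      ennreal (\<integral>q. measure \<mu> ({..<fst q} \<times> {..<snd q}) \<partial>\<mu>)"
    unfolding \<mu>.emeasure_eq_measure by (rule nn_integral_eq_integral[OF intbox]) auto
  ultimately have lt: "measure ?N lt = (\<integral>q. measure \<mu> ({..<fst q} \<times> {..<snd q}) \<partial>\<mu>)"
    and gt: "measure ?N gt = (\<integral>q. measure \<mu> ({..<fst q} \<times> {..<snd q}) \<partial>\<mu>)"
    by (auto simp: measure_def Bochner_Integration.integral_nonneg)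
  \<comment> \<open>Each slice of a tie event is a vertical or horizontal line, which has mass 0 by
    assumption.\<close>
  have "emeasure ?N tie1 = (\<integral>\<^sup>+q. emeasure \<mu> {p. fst p = fst q} \<partial>\<mu>)"
    unfolding emeasure_pair_measure_alt2[OF M(4)]
    by (intro nn_integral_cong arg_cong[where f = "emeasure \<mu>"]) (auto simp: tie1_def)
  hence tie1: "emeasure ?N tie1 = 0" by (simp add: \<mu>.emeasure_eq_measure fst)
  have "emeasure ?N tie2 = (\<integral>\<^sup>+q. emeasure \<mu> {p. snd p = snd q} \<partial>\<mu>)"
    unfolding emeasure_pair_measure_alt2[OF M(5)]
    by (intro nn_integral_cong arg_cong[where f = "emeasure \<mu>"]) (auto simp: tie2_def)
  hence tie2: "emeasure ?N tie2 = 0" by (simp add: \<mu>.emeasure_eq_measure snd)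
  have conc: "measure ?N (lt \<union> gt) = 2 * (\<integral>q. measure \<mu> ({..<fst q} \<times> {..<snd q}) \<partial>\<mu>)"
  proof -
    have "lt \<inter> gt = {}" by (auto simp: lt_def gt_def)
    from finite_measure_Union[OF M(1,2) this] show ?thesis by (simp add: lt gt)
  qed
  have "lt \<union> gt \<union> disc = UNIV - (tie1 \<union> tie2)"
    by (auto simp: lt_def gt_def disc_def tie1_def tie2_def mult_less_0_iff)
  moreover have "emeasure ?N (tie1 \<union> tie2) = 0"
    using emeasure_Un_null_set[of tie1 ?N tie2] tie1 tie2 M by (auto simp: null_sets_def)
  ultimately have "measure ?N (lt \<union> gt \<union> disc) = 1"
    using prob_compl[of "tie1 \<union> tie2"] M by (simp add: sN measure_def)
  moreover have "measure ?N (lt \<union> gt \<union> disc) = measure ?N (lt \<union> gt) + measure ?N disc"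
    using M by (intro finite_measure_Union) (auto simp: lt_def gt_def disc_def mult_less_0_iff)
  ultimately have disc: "measure ?N disc = 1 - measure ?N (lt \<union> gt)" by simp
  have "{((y1,z1),(y2,z2)). (y1 - y2) * (z1 - z2) > (0::real)} = lt \<union> gt"
    by (auto simp: lt_def gt_def zero_less_mult_iff)
  moreover have "{((y1,z1),(y2,z2)). (y1 - y2) * (z1 - z2) < (0::real)} = disc"
    by (auto simp: disc_def)
  ultimately show ?thesis unfolding kendall_tau_def by (simp add: disc conc)
qed

section \<open>Expectations under a signed mixture of product densities\<close>

lemma prod_two:
  fixes f :: "nat \<Rightarrow> 'a :: comm_monoid_mult"
  assumes "j1 < m" "j2 < m" "j1 \<noteq> j2" "\<And>r. r < m \<Longrightarrow> r \<noteq> j1 \<Longrightarrow> r \<noteq> j2 \<Longrightarrow> f r = 1"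
  shows "(\<Prod>r<m. f r) = f j1 * f j2"
proof -
  have "(\<Prod>r<m. f r) = prod f {j1, j2}"
    using assms by (intro prod.mono_neutral_right) auto
  thus ?thesis using assms by simp
qed

text \<open>With negative weights a single term need not be a law, but each term is integrable. The
  integral thus splits by linearity and factors by Fubini, and every coordinate other than
  \<open>j1\<close> and \<open>j2\<close> contributes its total mass 1. Indicators for
  \<open>a\<close> and \<open>b\<close> give the law of the pair; distribution functions give the
  outer expectation in Kendall's tau.\<close>

lemma signed_mixture_expectation:
  fixes D :: "nat \<Rightarrow> real \<Rightarrow> real" and p :: "(nat \<Rightarrow> nat) \<Rightarrow> real" and a b :: "real \<Rightarrow> real"
  assumes D: "\<And>k. k < L \<Longrightarrow> has_bochner_integral lborel (D k) 1"
    and nonneg: "\<And>x. x \<in> space (PiM {..<m} (\<lambda>_. lborel)) \<Longrightarrow>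
      0 \<le> (\<Sum>i\<in>PiE {..<m} (\<lambda>_. {..<L}). p i * (\<Prod>r<m. D (i r) (x r)))"
    and dens: "distributed P (PiM {..<m} (\<lambda>_. lborel)) (\<lambda>\<omega>. \<lambda>r\<in>{..<m}. X r \<omega>)
      (\<lambda>x. ennreal (\<Sum>i\<in>PiE {..<m} (\<lambda>_. {..<L}). p i * (\<Prod>r<m. D (i r) (x r))))"
    and j: "j1 < m" "j2 < m" "j1 \<noteq> j2"
    and a [measurable]: "a \<in> borel_measurable borel" and b [measurable]: "b \<in> borel_measurable borel"
    and bounds: "\<And>x. \<bar>a x\<bar> \<le> 1" "\<And>x. \<bar>b x\<bar> \<le> 1"
  shows "(\<integral>\<omega>. a (X j1 \<omega>) * b (X j2 \<omega>) \<partial>P) =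
    (\<Sum>i\<in>PiE {..<m} (\<lambda>_. {..<L}). p i * ((\<integral>x. a x * D (i j1) x \<partial>lborel) * (\<integral>x. b x * D (i j2) x \<partial>lborel)))"
proof -
  let ?S = "PiE {..<m} (\<lambda>_. {..<L})" and ?N = "PiM {..<m} (\<lambda>_. lborel :: real measure)"
  interpret product_sigma_finite "\<lambda>_ :: nat. lborel :: real measure" ..
  \<comment> \<open>Padding with the constant 1 turns the test function into a product over all
    coordinates, the form that the integral rules for product measures require.\<close>
  define e where "e r = (if r = j1 then a else if r = j2 then b else (\<lambda>_. 1))" for r
  have e [measurable]: "e r \<in> borel_measurable borel" and e1: "\<bar>e r x\<bar> \<le> 1" for r x
    using bounds by (auto simp: e_def)
  have ab: "a (x j1) * b (x j2) = (\<Prod>r<m. e r (x r))" for x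
    using prod_two[OF j, of "\<lambda>r. e r (x r)"] j by (simp add: e_def)
  have lt: "i r < L" if "i \<in> ?S" "r < m" for i r using that by auto
  have int: "integrable lborel (\<lambda>y. e r y * D (i r) y)" if "i \<in> ?S" "r < m" for i r
  proof (rule Bochner_Integration.integrable_bound)
    show "integrable lborel (D (i r))" using D[OF lt[OF that]] by (simp add: has_bochner_integral_iff)
    then show "(\<lambda>y. e r y * D (i r) y) \<in> borel_measurable lborel" by measurable
    show "AE y in lborel. norm (e r y * D (i r) y) \<le> norm (D (i r) y)"
      using mult_right_mono[OF e1 abs_ge_zero] by (auto simp: abs_mult)
  qed
  have [measurable]: "(\<lambda>x. x j1) \<in> borel_measurable ?N" "(\<lambda>x. x j2) \<in> borel_measurable ?N"
    using j measurable_component_singleton[of _ "{..<m}" "\<lambda>_. lborel :: real measure"] by auto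
  have "(\<lambda>x. a (x j1) * b (x j2)) \<in> borel_measurable ?N" by measurable
  from distributed_integral[OF dens this nonneg]
  have "(\<integral>\<omega>. a (X j1 \<omega>) * b (X j2 \<omega>) \<partial>P) =
      (\<integral>x. (\<Sum>i\<in>?S. p i * (\<Prod>r<m. D (i r) (x r))) * (a (x j1) * b (x j2)) \<partial>?N)"
    using j by simp
  also have "\<dots> = (\<integral>x. (\<Sum>i\<in>?S. p i * (\<Prod>r<m. e r (x r) * D (i r) (x r))) \<partial>?N)"
    unfolding ab by (simp add: sum_distrib_left prod.distrib mult_ac)
  also have "\<dots> = (\<Sum>i\<in>?S. p i * (\<integral>x. (\<Prod>r<m. e r (x r) * D (i r) (x r)) \<partial>?N))"
  proof (subst Bochner_Integration.integral_sum)
    fix i assume "i \<in> ?S"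
    thus "integrable ?N (\<lambda>x. p i * (\<Prod>r<m. e r (x r) * D (i r) (x r)))"
      using int by (intro integrable_mult_right product_integrable_prod) auto
  qed simp
  also have "\<dots> = (\<Sum>i\<in>?S. p i * (\<Prod>r<m. \<integral>y. e r y * D (i r) y \<partial>lborel))"
  proof (intro sum.cong refl arg_cong2[where f = "(*)"])
    fix i assume "i \<in> ?S"
    thus "(\<integral>x. (\<Prod>r<m. e r (x r) * D (i r) (x r)) \<partial>?N) = (\<Prod>r<m. \<integral>y. e r y * D (i r) y \<partial>lborel)"
      using int by (intro product_integral_prod) auto
  qed
  also have "\<dots> = (\<Sum>i\<in>?S. p i * ((\<integral>x. a x * D (i j1) x \<partial>lborel) * (\<integral>x. b x * D (i j2) x \<partial>lborel)))"
  proof (intro sum.cong refl arg_cong2[where f = "(*)"])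
    fix i assume i: "i \<in> ?S"
    have "(\<integral>y. e r y * D (i r) y \<partial>lborel) = 1" if "r < m" "r \<noteq> j1" "r \<noteq> j2" for r
      using D[OF lt[OF i that(1)]] that by (simp add: e_def has_bochner_integral_iff)
    from prod_two[OF j, of "\<lambda>r. \<integral>y. e r y * D (i r) y \<partial>lborel", OF this]
    show "(\<Prod>r<m. \<integral>y. e r y * D (i r) y \<partial>lborel) =
        (\<integral>x. a x * D (i j1) x \<partial>lborel) * (\<integral>x. b x * D (i j2) x \<partial>lborel)"
      using j by (simp add: e_def)
  qed
  finally show ?thesis .
qed

theorem theorem6:
  fixes P :: "'a measure" and X :: "nat \<Rightarrow> 'a \<Rightarrow> real"
    and L m :: nat and n :: "nat \<Rightarrow> nat"
    and \<alpha> t :: "nat \<Rightarrow> real vec" and T :: "nat \<Rightarrow> real mat"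
    and p :: "(nat \<Rightarrow> nat) \<Rightarrow> real" and j1 j2 :: nat
  assumes "prob_space P"
    and "L \<ge> 1" and "m \<ge> 1"
    and ME: "\<And>k. k < L \<Longrightarrow> ME_triple (n k) (\<alpha> k) (T k) (t k)"
    and psum: "(\<Sum>i\<in>PiE {..<m} (\<lambda>_. {..<L}). p i) = 1"
    and fnonneg: "\<And>x. (\<forall>r<m. x r \<ge> 0) \<Longrightarrow> MMEam_fun L m \<alpha> T t p x \<ge> 0"
    and dens: "distributed P (PiM {..<m} (\<lambda>_. lborel)) (\<lambda>\<omega>. \<lambda>r\<in>{..<m}. X r \<omega>)
                 (\<lambda>x. ennreal (if (\<forall>r<m. x r \<ge> 0) then MMEam_fun L m \<alpha> T t p x else 0))"
    and "j1 < m" and "j2 < m" and "j1 \<noteq> j2"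
  shows "kendall_tau (distr P (borel \<Otimes>\<^sub>M borel) (\<lambda>\<omega>. (X j1 \<omega>, X j2 \<omega>))) =
    4 * (\<Sum>i\<in>PiE {..<m} (\<lambda>_. {..<L}). \<Sum>i'\<in>PiE {..<m} (\<lambda>_. {..<L}).
           p i * p i' * c_coef \<alpha> T t i i' j1 * c_coef \<alpha> T t i i' j2) - 1"
proof -
  interpret P: prob_space P by fact
  let ?S = "PiE {..<m} (\<lambda>_. {..<L})"
  define \<mu> where "\<mu> = distr P (borel \<Otimes>\<^sub>M borel) (\<lambda>\<omega>. (X j1 \<omega>, X j2 \<omega>))"
  define D where "D k = ME_density (\<alpha> k) (T k) (t k)" for k
  define F where "F k = ME_cdf (\<alpha> k) (T k) (t k)" for k
  have lt: "i r < L" if "i \<in> ?S" "r < m" for i r using that by auto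
  have X: "X r \<in> borel_measurable P" if "r < m" for r
  proof -
    have "r \<in> {..<m}" using that by simp
    from measurable_compose[OF distributed_measurable[OF dens] measurable_component_singleton[OF this]]
    have "(\<lambda>\<omega>. (\<lambda>r\<in>{..<m}. X r \<omega>) r) \<in> measurable P lborel" .
    thus ?thesis using that by simp
  qed
  note [measurable] = X[OF \<open>j1 < m\<close>] X[OF \<open>j2 < m\<close>]
  \<comment> \<open>A negative coordinate makes one factor of every term vanish, so the case
    distinction is absorbed into the extended densities \<open>D\<close>.\<close>
  have dens_eq: "(if (\<forall>r<m. x r \<ge> 0) then MMEam_fun L m \<alpha> T t p x else 0) =
      (\<Sum>i\<in>?S. p i * (\<Prod>r<m. D (i r) (x r)))" for x
  proof (cases "\<forall>r<m. x r \<ge> 0")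
    case True
    thus ?thesis by (auto simp: MMEam_fun_def D_def ME_density_def intro!: sum.cong prod.cong)
  next
    case False
    then obtain r where "r < m" "x r < 0" by (auto simp: not_le)
    hence "(\<Prod>r<m. D (i r) (x r)) = 0" for i
      by (auto simp: D_def ME_density_def intro!: prod_zero bexI[of _ r])
    thus ?thesis by (simp add: if_not_P[OF False] del: prod_zero_iff)
  qed
  have nonneg: "0 \<le> (\<Sum>i\<in>?S. p i * (\<Prod>r<m. D (i r) (x r)))" for x
    unfolding dens_eq[symmetric] using fnonneg by simp
  note expectation = signed_mixture_expectation[of L D m p P X j1 j2,
      OF _ nonneg dens[unfolded dens_eq] \<open>j1 < m\<close> \<open>j2 < m\<close> \<open>j1 \<noteq> j2\<close>]
  have D: "has_bochner_integral lborel (D k) 1" if "k < L" for k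
    unfolding D_def by (rule ME_density_integral[OF ME[OF that]])
  \<comment> \<open>Indicators as test functions turn the expectation formula into the mass of a
    rectangle.\<close>
  have measure_box: "measure \<mu> (A \<times> B) =
      (\<Sum>i\<in>?S. p i * ((\<integral>x. indicator A x * D (i j1) x \<partial>lborel) * (\<integral>x. indicator B x * D (i j2) x \<partial>lborel)))"
    if [measurable]: "A \<in> sets borel" "B \<in> sets borel" for A B
  proof -
    have "measure \<mu> (A \<times> B) = measure P ((\<lambda>\<omega>. (X j1 \<omega>, X j2 \<omega>)) -` (A \<times> B) \<inter> space P)"
      unfolding \<mu>_def by (rule measure_distr) auto
    also have "\<dots> = (\<integral>\<omega>. indicator ((\<lambda>\<omega>. (X j1 \<omega>, X j2 \<omega>)) -` (A \<times> B)) \<omega> \<partial>P)"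
      by simp
    also have "\<dots> = (\<integral>\<omega>. indicator A (X j1 \<omega>) * indicator B (X j2 \<omega>) \<partial>P)"
      by (intro Bochner_Integration.integral_cong) (auto simp: indicator_def)
    finally show ?thesis
      using expectation[OF D, of "indicator A" "indicator B"] by (simp add: indicator_def)
  qed
  have no_atom: "(\<integral>x. indicator {y} x * D k x \<partial>lborel) = 0" for y k
  proof -
    have "AE x in lborel. indicator {y} x * D k x = 0"
      using AE_lborel_singleton[of y] by eventually_elim auto
    thus ?thesis by (rule integral_eq_zero_AE)
  qed
  \<comment> \<open>As rectangles with a singleton side, these lines are covered by
    \<open>measure_box\<close>, where every term contains an integral over one point.\<close>
  have "{q. fst q = y} = {y} \<times> (UNIV :: real set)" "{q. snd q = y} = (UNIV :: real set) \<times> {y}" for y :: real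
    by auto
  hence ties: "measure \<mu> {q. fst q = y} = 0" "measure \<mu> {q. snd q = y} = 0" for y
    by (auto simp: measure_box no_atom)
  have F01: "F k y \<in> {0..1}" if "k < L" for k y
    unfolding F_def by (rule ME_cdf_range[OF ME[OF that]])
  have Fm: "F k \<in> borel_measurable borel" if "k < L" for k
    unfolding F_def by (rule ME_cdf_measurable[OF ME[OF that]])
  have FD: "(\<integral>x. indicator {..<y} x * D k x \<partial>lborel) = F k y" if "k < L" for k y
    unfolding D_def F_def
    by (rule has_bochner_integral_integral_eq[OF ME_density_lessThan_integral[OF ME[OF that]]])
  \<comment> \<open>The distribution function carries the index \<open>i\<close> and the density the
    index \<open>i'\<close>, in agreement with \<open>l\<close> and \<open>t\<close> in
    \<open>c_coef\<close>.\<close>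
  have c: "(\<integral>x. F (i r) x * D (i' r) x \<partial>lborel) = c_coef \<alpha> T t i i' r" if "i \<in> ?S" "i' \<in> ?S" "r < m" for i i' r
    unfolding D_def F_def c_coef_def
    by (rule has_bochner_integral_integral_eq[OF ME_cdf_density_integral])
       (rule ME[OF lt[OF that(1,3)]] ME[OF lt[OF that(2,3)]])+
  \<comment> \<open>The joint distribution function of the pair is the same signed mixture of
    products of the one-dimensional distribution functions.\<close>
  have box: "measure \<mu> ({..<y} \<times> {..<z}) = (\<Sum>i\<in>?S. p i * (F (i j1) y * F (i j2) z))" for y z
    using \<open>j1 < m\<close> \<open>j2 < m\<close> lt by (simp add: measure_box FD cong: sum.cong)
  have [measurable]: "(\<lambda>\<omega>. F (i j1) (X j1 \<omega>) * F (i j2) (X j2 \<omega>)) \<in> borel_measurable P" if "i \<in> ?S" for i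
    using Fm[OF lt[OF that \<open>j1 < m\<close>]] Fm[OF lt[OF that \<open>j2 < m\<close>]] by measurable
  have "kendall_tau \<mu> = 4 * (\<integral>q. measure \<mu> ({..<fst q} \<times> {..<snd q}) \<partial>\<mu>) - 1"
  proof (rule kendall_tau_no_ties)
    show "prob_space \<mu>" unfolding \<mu>_def by (rule P.prob_space_distr) measurable
    show "sets \<mu> = sets (borel \<Otimes>\<^sub>M borel)" by (simp add: \<mu>_def)
  qed (fact ties)+
  also have "(\<integral>q. measure \<mu> ({..<fst q} \<times> {..<snd q}) \<partial>\<mu>) =
      (\<integral>\<omega>. (\<Sum>i\<in>?S. p i * (F (i j1) (X j1 \<omega>) * F (i j2) (X j2 \<omega>))) \<partial>P)"
  proof -
    have "(\<lambda>q. \<Sum>i\<in>?S. p i * (F (i j1) (fst q) * F (i j2) (snd q))) \<in> borel_measurable (borel \<Otimes>\<^sub>M borel)"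
    proof (rule borel_measurable_sum)
      fix i assume "i \<in> ?S"
      note [measurable] = Fm[OF lt[OF this \<open>j1 < m\<close>]] Fm[OF lt[OF this \<open>j2 < m\<close>]]
      show "(\<lambda>q. p i * (F (i j1) (fst q) * F (i j2) (snd q))) \<in> borel_measurable (borel \<Otimes>\<^sub>M borel)"
        by measurable
    qed
    thus ?thesis unfolding box by (subst \<mu>_def) (simp add: integral_distr)
  qed
  also have "\<dots> = (\<Sum>i\<in>?S. p i * (\<integral>\<omega>. F (i j1) (X j1 \<omega>) * F (i j2) (X j2 \<omega>) \<partial>P))"
  proof (subst Bochner_Integration.integral_sum)
    fix i assume i: "i \<in> ?S"
    show "integrable P (\<lambda>\<omega>. p i * (F (i j1) (X j1 \<omega>) * F (i j2) (X j2 \<omega>)))"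
    proof (intro integrable_mult_right P.integrable_const_bound[of _ 1] AE_I2)
      show "norm (F (i j1) (X j1 \<omega>) * F (i j2) (X j2 \<omega>)) \<le> 1" for \<omega>
        using F01[OF lt[OF i \<open>j1 < m\<close>], of "X j1 \<omega>"] F01[OF lt[OF i \<open>j2 < m\<close>], of "X j2 \<omega>"]
        by (auto simp: abs_mult intro!: mult_le_one)
    qed (use i in measurable)
  qed simp
  \<comment> \<open>Second use of the expectation formula: \<open>i\<close> stems from the joint
    distribution function, \<open>i'\<close> from the density against which it is averaged.\<close>
  also have "\<dots> = (\<Sum>i\<in>?S. p i * (\<Sum>i'\<in>?S. p i' * (c_coef \<alpha> T t i i' j1 * c_coef \<alpha> T t i i' j2)))"
  proof (intro sum.cong refl arg_cong2[where f = "(*)"])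
    fix i assume i: "i \<in> ?S"
    have "\<bar>F (i j1) x\<bar> \<le> 1" "\<bar>F (i j2) x\<bar> \<le> 1" for x
      using F01[OF lt[OF i \<open>j1 < m\<close>], of x] F01[OF lt[OF i \<open>j2 < m\<close>], of x] by auto
    from expectation[OF D Fm[OF lt[OF i \<open>j1 < m\<close>]] Fm[OF lt[OF i \<open>j2 < m\<close>]] this]
    show "(\<integral>\<omega>. F (i j1) (X j1 \<omega>) * F (i j2) (X j2 \<omega>) \<partial>P) =
        (\<Sum>i'\<in>?S. p i' * (c_coef \<alpha> T t i i' j1 * c_coef \<alpha> T t i i' j2))"
      using i \<open>j1 < m\<close> \<open>j2 < m\<close> by (simp add: c cong: sum.cong)
  qed
  finally show ?thesis
    unfolding \<mu>_def by (simp add: sum_distrib_left mult.assoc)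
qed

end
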